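(* Let $k>0$ be real, let $\lambda=(\lambda_1,\lambda_2)$ be a partition (integers $\lambda_1\ge\lambda_2\ge 0$), and let $x=(x_1,x_2)$, $y=(y_1,y_2)$ with $x_1,x_2,y_1,y_2$ nonnegative real numbers. For $u\in[-1,1]$ put $$\alpha(u)=\tfrac12\Big((x_1+x_2)(y_1+y_2)+(x_1-x_2)(y_1-y_2)\,u\Big),$$ $$X_1(u)=\tfrac12\Big(\alpha(u)+\sqrt{\alpha(u)^2-4x_1x_2y_1y_2}\Big),\qquad X_2(u)=\tfrac12\Big(\alpha(u)-\sqrt{\alpha(u)^2-4x_1x_2y_1y_2}\Big).$$ Then the two-variable Jack polynomial $P_\lambda^k$ satisfies $$\frac{P_\lambda^k(x)\,P_\lambda^k(y)}{P_\lambda^k(1,1)}=\frac{\Gamma(k+1/2)}{\Gamma(k)\sqrt{\pi}}\int_{-1}^1P_\lambda^k\big(X_1(u),X_2(u)\big)\,(1-u^2)^{k-1}\,du.$$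
   Context: For a partition $\lambda=(\lambda_1,\lambda_2)$, $|\lambda|=\lambda_1+\lambda_2$, and the monomial symmetric function is $m_\lambda(x_1,x_2)=x_1^{\lambda_1}x_2^{\lambda_2}+x_2^{\lambda_1}x_1^{\lambda_2}$. Write $\mu<\lambda$ if $\mu\neq\lambda$, $|\mu|=|\lambda|$ and $\mu_1\le\lambda_1$ (dominance order). For $k>0$ the Jack polynomial $P_\lambda^k$ in two variables is the unique symmetric polynomial of the form $m_\lambda+\sum_{\mu<\lambda}a_{\mu\lambda}m_\mu$ that is an eigenfunction of the operator $$x_1^2\frac{\partial^2}{\partial x_1^2}+x_2^2\frac{\partial^2}{\partial x_2^2}+2k\left\{\frac{x_1^2}{x_1-x_2}\frac{\partial}{\partial x_1}+\frac{x_2^2}{x_2-x_1}\frac{\partial}{\partial x_2}\right\},$$ with eigenvalue $e_\lambda=\lambda_1(\lambda_1+2k-1)+\lambda_2(\lambda_2-1)$. (The Jack parameter $\alpha_{\mathrm{Jack}}$ is related to $k$ by $k=1/\alpha_{\mathrm{Jack}}$.) The quantity under the square root is nonnegative for nonnegative $x_i,y_i$ and $u\in[-1,1]$. *)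

theory Defs
  imports "HOL-Analysis.Analysis"
begin

definition is_partition2 :: "nat \<times> nat \<Rightarrow> bool" where
  "is_partition2 l \<longleftrightarrow> snd l \<le> fst l"

definition size2 :: "nat \<times> nat \<Rightarrow> nat" where
  "size2 l = fst l + snd l"

text \<open>For \<open>l = (n, n)\<close> the following is \<open>2 * x1 ^ n * x2 ^ n\<close>, that is, twice
  the other common normalisation of the monomial symmetric function.\<close>

definition msym2 :: "nat \<times> nat \<Rightarrow> real \<Rightarrow> real \<Rightarrow> real" where
  "msym2 l x1 x2 = x1 ^ fst l * x2 ^ snd l + x2 ^ fst l * x1 ^ snd l"

definition dominated2 :: "nat \<times> nat \<Rightarrow> nat \<times> nat \<Rightarrow> bool" where
  "dominated2 m l \<longleftrightarrow> m \<noteq> l \<and> size2 m = size2 l \<and> fst m \<le> fst l"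

text \<open>A meaningful value is obtained only off the diagonal \<open>x1 = x2\<close>.\<close>

definition jack_operator2 ::
    "real \<Rightarrow> (real \<Rightarrow> real \<Rightarrow> real) \<Rightarrow> real \<Rightarrow> real \<Rightarrow> real" where
  "jack_operator2 k P x1 x2 =
     x1\<^sup>2 * deriv (deriv (\<lambda>t. P t x2)) x1 + x2\<^sup>2 * deriv (deriv (\<lambda>t. P x1 t)) x2
     + 2 * k * (x1\<^sup>2 / (x1 - x2) * deriv (\<lambda>t. P t x2) x1
              + x2\<^sup>2 / (x2 - x1) * deriv (\<lambda>t. P x1 t) x2)"

definition jack_eigenvalue2 :: "real \<Rightarrow> nat \<times> nat \<Rightarrow> real" where
  "jack_eigenvalue2 k l =
     real (fst l) * (real (fst l) + 2 * k - 1) + real (snd l) * (real (snd l) - 1)"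

text \<open>Polynomials are represented by the real functions they induce. The eigenvalue
  equation is an identity of rational functions, required wherever \<open>x1 \<noteq> x2\<close>.\<close>

definition is_jack2 :: "real \<Rightarrow> nat \<times> nat \<Rightarrow> (real \<Rightarrow> real \<Rightarrow> real) \<Rightarrow> bool" where
  "is_jack2 k l P \<longleftrightarrow>
     (\<exists>a :: nat \<times> nat \<Rightarrow> real. \<forall>x1 x2. P x1 x2 =
        msym2 l x1 x2 + (\<Sum>m | is_partition2 m \<and> dominated2 m l. a m * msym2 m x1 x2)) \<and>
     (\<forall>x1 x2. x1 \<noteq> x2 \<longrightarrow> jack_operator2 k P x1 x2 = jack_eigenvalue2 k l * P x1 x2)"

definition jack2 :: "real \<Rightarrow> nat \<times> nat \<Rightarrow> real \<Rightarrow> real \<Rightarrow> real" where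
  "jack2 k l = (THE P. is_jack2 k l P)"

definition prod_alpha :: "real \<Rightarrow> real \<Rightarrow> real \<Rightarrow> real \<Rightarrow> real \<Rightarrow> real" where
  "prod_alpha x1 x2 y1 y2 u =
     1 / 2 * ((x1 + x2) * (y1 + y2) + (x1 - x2) * (y1 - y2) * u)"

definition prod_X1 :: "real \<Rightarrow> real \<Rightarrow> real \<Rightarrow> real \<Rightarrow> real \<Rightarrow> real" where
  "prod_X1 x1 x2 y1 y2 u =
     1 / 2 * (prod_alpha x1 x2 y1 y2 u
              + sqrt ((prod_alpha x1 x2 y1 y2 u)\<^sup>2 - 4 * x1 * x2 * y1 * y2))"

definition prod_X2 :: "real \<Rightarrow> real \<Rightarrow> real \<Rightarrow> real \<Rightarrow> real \<Rightarrow> real" where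
  "prod_X2 x1 x2 y1 y2 u =
     1 / 2 * (prod_alpha x1 x2 y1 y2 u
              - sqrt ((prod_alpha x1 x2 y1 y2 u)\<^sup>2 - 4 * x1 * x2 * y1 * y2))"

end

theory Submission
  imports Defs
begin

text \<open>
  Write \<open>\<kappa>\<^sub>i\<close> for the coefficient of \<open>z\<^sup>i\<close> in \<open>(1 - z)\<close> to the power \<open>-k\<close>. The Jack polynomial of
  \<open>(s + n, s)\<close> is, up to a constant, \<open>(x1 x2)\<^sup>s\<close> times
  \<open>Q\<^sub>n(x1, x2) = \<Sum>\<^sub>i \<kappa>\<^sub>i \<kappa>\<^sub>n\<^sub>-\<^sub>i x1\<^sup>i x2\<^sup>n\<^sup>-\<^sup>i\<close>, a homogeneous form of the Gegenbauer polynomial of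
  degree \<open>n\<close>. The reason is that the eigenvalue equation, after multiplication by \<open>x1 - x2\<close>, is a
  first-order recurrence for the coefficients of the polynomial, and \<open>\<kappa>\<^sub>i \<kappa>\<^sub>n\<^sub>-\<^sub>i\<close> is its only solution up
  to a factor (\<open>eigen_equation_iff_jack_recurrence\<close>, \<open>is_jack2_iff\<close>).

  Since \<open>X1 X2 = x1 x2 y1 y2\<close>, the factors \<open>(x1 x2)\<^sup>s\<close> match on both sides, and the product formula is
  one for \<open>Q\<^sub>n\<close>. The integral of \<open>Q\<^sub>n(X1(u), X2(u))\<close> against the weight is, for fixed \<open>y1\<close> and \<open>y2\<close>,
  a polynomial in \<open>x1\<close> and \<open>x2\<close>, homogeneous of degree \<open>n\<close>. Its coefficients satisfy the
  same recurrence, so it is a multiple of \<open>Q\<^sub>n(x1, x2)\<close>; at \<open>x1 = x2 = 1\<close> the integrand is the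
  weight times the constant \<open>Q\<^sub>n(y1, y2)\<close>, and this determines the multiple.

  For the recurrence, put \<open>A = (y1 + y2 + (y1 - y2) u) / 2\<close>,
  \<open>B = (y1 + y2 - (y1 - y2) u) / 2\<close> and \<open>q = y1 y2\<close>, so that \<open>X1 + X2 = x1 A + x2 B\<close> and
  \<open>X1 X2 = x1 x2 q\<close>. The generating function of the \<open>Q\<^sub>n\<close> shows that the coefficient of
  \<open>x1\<^sup>a x2\<^sup>b\<close> in \<open>Q\<^sub>n(X1, X2)\<close>, where \<open>a + b = n\<close>, is the coefficient of \<open>s\<^sup>a t\<^sup>b\<close> in the power
  \<open>-k\<close> of \<open>1 - A s - B t + q s t\<close>. These coefficients obey contiguity relations
  (\<open>product_coeff_contiguity\<close> and its mirror image). Because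
  \<open>A B - q = (y1 - y2)\<^sup>2 (1 - u\<^sup>2) / 4\<close>, the two relations combine to the statement that the
  defect in the recurrence, multiplied by the weight, is the derivative of a function
  vanishing at \<open>u = 1\<close> and \<open>u = -1\<close>, whence its integral is zero.
\<close>

section \<open>The recurrence for Jack coefficients\<close>

text \<open>
  Quantifying over the pair of \<open>i\<close> and \<open>j = n - 1 - i\<close> keeps truncated subtraction out of the recurrence.
\<close>
definition jack_recurrence :: "real \<Rightarrow> nat \<Rightarrow> (nat \<Rightarrow> real) \<Rightarrow> bool" where
  "jack_recurrence k n c \<longleftrightarrow>
     (\<forall>i j. Suc (i + j) = n \<longrightarrow>
        (real j + 1) * (real i + k) * c i = (real i + 1) * (real j + k) * c (Suc i))"

text \<open>
  The coefficient of \<open>z\<^sup>i\<close> in \<open>(1 - z)\<close> to the power \<open>-k\<close>.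
\<close>
definition neg_binom_coeff :: "real \<Rightarrow> nat \<Rightarrow> real" where
  "neg_binom_coeff k i = pochhammer k i / fact i"

lemma neg_binom_coeff_0 [simp]: "neg_binom_coeff k 0 = 1"
  by (simp add: neg_binom_coeff_def)

lemma neg_binom_coeff_Suc: "(real i + 1) * neg_binom_coeff k (Suc i) = (real i + k) * neg_binom_coeff k i"
proof -
  have "(real i + 1) * (pochhammer k (Suc i) / fact (Suc i)) = pochhammer k (Suc i) / fact i"
    unfolding fact_Suc by (simp add: add.commute del: of_nat_Suc pochhammer_Suc) (simp add: add.commute)
  then show ?thesis
    by (simp add: neg_binom_coeff_def pochhammer_Suc add.commute mult.commute)
qed

lemma neg_binom_coeff_pos: "k > 0 \<Longrightarrow> neg_binom_coeff k i > 0"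
  by (simp add: neg_binom_coeff_def pochhammer_pos)

lemma jack_recurrence_neg_binom_coeff:
  "jack_recurrence k n (\<lambda>i. C * (neg_binom_coeff k i * neg_binom_coeff k (n - i)))"
  unfolding jack_recurrence_def
proof (intro allI impI)
  fix i j :: nat
  assume "Suc (i + j) = n"
  then have d: "n - i = Suc j" "n - Suc i = j" by auto
  have "(real j + 1) * (real i + k) * (C * (neg_binom_coeff k i * neg_binom_coeff k (Suc j))) =
        C * ((real i + k) * neg_binom_coeff k i) * ((real j + 1) * neg_binom_coeff k (Suc j))"
    by (simp add: algebra_simps)
  also have "\<dots> = (real i + 1) * (real j + k) * (C * (neg_binom_coeff k (Suc i) * neg_binom_coeff k j))"
    unfolding neg_binom_coeff_Suc[of j] neg_binom_coeff_Suc[of i, symmetric] by (simp add: algebra_simps)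
  finally show "(real j + 1) * (real i + k) * (C * (neg_binom_coeff k i * neg_binom_coeff k (n - i))) =
      (real i + 1) * (real j + k) * (C * (neg_binom_coeff k (Suc i) * neg_binom_coeff k (n - Suc i)))"
    unfolding d .
qed

lemma jack_recurrence_unique:
  assumes "k > 0" and c: "jack_recurrence k n c" and d: "jack_recurrence k n d"
    and "c 0 = d 0" and "i \<le> n"
  shows "c i = d i"
  using \<open>i \<le> n\<close>
proof (induction i)
  case 0
  show ?case by fact
next
  case (Suc i)
  define j where "j = n - Suc i"
  have n: "Suc (i + j) = n" using Suc.prems by (simp add: j_def)
  have "(real i + 1) * (real j + k) * c (Suc i) = (real i + 1) * (real j + k) * d (Suc i)"
    using c d n Suc unfolding jack_recurrence_def by (metis Suc_leD)
  moreover have "(real i + 1) * (real j + k) \<noteq> 0"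
    using \<open>k > 0\<close> by (simp add: add_nonneg_eq_0_iff)
  ultimately show ?case
    using mult_left_cancel by blast
qed

lemma jack_recurrence_solution:
  assumes "k > 0" and "jack_recurrence k n c" and "i \<le> n"
  shows "c i = c 0 / neg_binom_coeff k n * (neg_binom_coeff k i * neg_binom_coeff k (n - i))"
  using jack_recurrence_unique[OF assms(1,2)
      jack_recurrence_neg_binom_coeff[of k n "c 0 / neg_binom_coeff k n"] _ assms(3)]
    neg_binom_coeff_pos[OF assms(1), of n] by simp

section \<open>The eigenvalue equation as a recurrence\<close>

definition binary_form :: "nat \<Rightarrow> nat \<Rightarrow> (nat \<Rightarrow> real) \<Rightarrow> real \<Rightarrow> real \<Rightarrow> real" where
  "binary_form s n c x1 x2 = (\<Sum>i\<le>n. c i * (x1 ^ (s + i) * x2 ^ (s + (n - i))))"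

text \<open>
  The factors \<open>t\<close> and \<open>t\<^sup>2\<close> make both derivatives act diagonally on monomials, which also disposes
  of the exponents \<open>e i - 1\<close> and \<open>e i - 2\<close> when they would be negative.
\<close>
lemma power_sum_derivs:
  fixes g :: "nat \<Rightarrow> real" and e :: "nat \<Rightarrow> nat"
  assumes f_def: "f = (\<lambda>t. \<Sum>i\<le>n. g i * t ^ e i)"
  shows "t * deriv f t = (\<Sum>i\<le>n. g i * (real (e i) * t ^ e i))"
    and "t\<^sup>2 * deriv (deriv f) t = (\<Sum>i\<le>n. g i * (real (e i) * (real (e i) - 1) * t ^ e i))"
proof -
  have d: "deriv f = (\<lambda>t. \<Sum>i\<le>n. g i * (real (e i) * t ^ (e i - 1)))"
    unfolding f_def
    by (rule ext, rule DERIV_imp_deriv) (auto intro!: derivative_eq_intros sum.cong)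
  have dd: "deriv (deriv f) = (\<lambda>t. \<Sum>i\<le>n. g i * (real (e i) * (real (e i - 1) * t ^ (e i - 1 - 1))))"
    unfolding d
    by (rule ext, rule DERIV_imp_deriv) (auto intro!: derivative_eq_intros sum.cong)
  have p1: "t * (a * (real m * t ^ (m - 1))) = a * (real m * t ^ m)" for a m
    by (cases m) auto
  show "t * deriv f t = (\<Sum>i\<le>n. g i * (real (e i) * t ^ e i))"
    unfolding d sum_distrib_left p1 ..
  have p2: "t\<^sup>2 * (a * (real m * (real (m - 1) * t ^ (m - 1 - 1)))) =
      a * (real m * (real m - 1) * t ^ m)" for a m
  proof -
    consider "m = 0" | "m = 1" | l where "m = Suc (Suc l)"
      by (metis One_nat_def not0_implies_Suc)
    then show ?thesis
      by cases (auto simp: power2_eq_square)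
  qed
  show "t\<^sup>2 * deriv (deriv f) t = (\<Sum>i\<le>n. g i * (real (e i) * (real (e i) - 1) * t ^ e i))"
    unfolding dd sum_distrib_left p2 ..
qed

text \<open>
  Multiplication by \<open>x1 - x2\<close> turns each monomial into two neighbouring ones. With
  \<open>j = n - i\<close>, the numbers \<open>2 j (i + k)\<close> and \<open>2 i (j + k)\<close> are the amounts by which the eigenvalue
  of \<open>(s + n, s)\<close> exceeds the eigenvalue formula at the exponents \<open>(s + i, s + j)\<close> and
  \<open>(s + j, s + i)\<close>.
\<close>
lemma jack_operator2_binary_form:
  assumes "x1 \<noteq> x2"
  shows "(x1 - x2) * (jack_operator2 k (binary_form s n c) x1 x2
           - jack_eigenvalue2 k (s + n, s) * binary_form s n c x1 x2) =
    (\<Sum>i\<le>n. c i * (2 * real i * (real (n - i) + k) * (x1 ^ (s + i) * x2 ^ Suc (s + (n - i))) -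
       2 * real (n - i) * (real i + k) * (x1 ^ Suc (s + i) * x2 ^ (s + (n - i)))))"
proof -
  let ?M = "\<lambda>i. x1 ^ (s + i) * x2 ^ (s + (n - i))"
  have dd1: "x1\<^sup>2 * deriv (deriv (\<lambda>t. binary_form s n c t x2)) x1 =
      (\<Sum>i\<le>n. c i * (real (s + i) * (real (s + i) - 1) * ?M i))"
    and d1: "x1 * deriv (\<lambda>t. binary_form s n c t x2) x1 = (\<Sum>i\<le>n. c i * (real (s + i) * ?M i))"
    using power_sum_derivs[where t = x1 and f = "\<lambda>t. binary_form s n c t x2" and n = n and e = "\<lambda>i. s + i"
        and g = "\<lambda>i. c i * x2 ^ (s + (n - i))"]
    by (simp_all add: binary_form_def mult_ac)
  have dd2: "x2\<^sup>2 * deriv (deriv (\<lambda>t. binary_form s n c x1 t)) x2 =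
      (\<Sum>i\<le>n. c i * (real (s + (n - i)) * (real (s + (n - i)) - 1) * ?M i))"
    and d2: "x2 * deriv (\<lambda>t. binary_form s n c x1 t) x2 =
      (\<Sum>i\<le>n. c i * (real (s + (n - i)) * ?M i))"
    using power_sum_derivs[where t = x2 and f = "\<lambda>t. binary_form s n c x1 t" and n = n and e = "\<lambda>i. s + (n - i)"
        and g = "\<lambda>i. c i * x1 ^ (s + i)"]
    by (simp_all add: binary_form_def mult_ac)
  \<comment> \<open>Multiplication by \<open>x1 - x2\<close> clears the denominators of the first-order part.\<close>
  have clear: "(x1 - x2) * (x1\<^sup>2 * P + x2\<^sup>2 * Q + 2 * k * (x1\<^sup>2 / (x1 - x2) * R + x2\<^sup>2 / (x2 - x1) * S))
      = (x1 - x2) * (x1\<^sup>2 * P) + (x1 - x2) * (x2\<^sup>2 * Q) + (2 * k * x1 * (x1 * R) - 2 * k * x2 * (x2 * S))"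
    for P Q R S
  proof -
    have "(x1 - x2) * (x1\<^sup>2 / (x1 - x2) * R) = x1 * (x1 * R)"
      using assms by (simp add: power2_eq_square)
    moreover have "(x1 - x2) * (x2\<^sup>2 / (x2 - x1) * S) = - (x2 * (x2 * S))"
    proof -
      have "(x1 - x2) / (x2 - x1) = -1" using assms by (simp add: field_simps)
      moreover have "(x1 - x2) * (x2\<^sup>2 / (x2 - x1) * S) = (x1 - x2) / (x2 - x1) * (x2 * (x2 * S))"
        by (simp add: power2_eq_square)
      ultimately show ?thesis by simp
    qed
    ultimately show ?thesis by (simp only: distrib_left mult.left_commute[of "x1 - x2" "2 * k"])
  qed
  have "(x1 - x2) * (jack_operator2 k (binary_form s n c) x1 x2
           - jack_eigenvalue2 k (s + n, s) * binary_form s n c x1 x2) =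
    (\<Sum>i\<le>n. (x1 - x2) * (c i * (real (s + i) * (real (s + i) - 1) * ?M i))
      + (x1 - x2) * (c i * (real (s + (n - i)) * (real (s + (n - i)) - 1) * ?M i))
      + (2 * k * x1 * (c i * (real (s + i) * ?M i)) - 2 * k * x2 * (c i * (real (s + (n - i)) * ?M i)))
      - (x1 - x2) * (jack_eigenvalue2 k (s + n, s) * (c i * ?M i)))"
    unfolding right_diff_distrib[of "x1 - x2" "jack_operator2 k (binary_form s n c) x1 x2"]
    unfolding jack_operator2_def
    unfolding clear
    unfolding dd1 d1 dd2 d2
    unfolding binary_form_def sum_distrib_left sum.distrib sum_subtractf ..
  also have "\<dots> = (\<Sum>i\<le>n. c i * (2 * real i * (real (n - i) + k) * (x1 ^ (s + i) * x2 ^ Suc (s + (n - i))) -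
       2 * real (n - i) * (real i + k) * (x1 ^ Suc (s + i) * x2 ^ (s + (n - i)))))"
  proof (rule sum.cong)
    fix i assume "i \<in> {..n}"
    define j where "j = n - i"
    define X Y where "X = x1 ^ (s + i)" and "Y = x2 ^ (s + j)"
    have n: "real n = real i + real j" using \<open>i \<in> {..n}\<close> by (simp add: j_def of_nat_diff)
    show "(x1 - x2) * (c i * (real (s + i) * (real (s + i) - 1) * ?M i))
      + (x1 - x2) * (c i * (real (s + (n - i)) * (real (s + (n - i)) - 1) * ?M i))
      + (2 * k * x1 * (c i * (real (s + i) * ?M i)) - 2 * k * x2 * (c i * (real (s + (n - i)) * ?M i)))
      - (x1 - x2) * (jack_eigenvalue2 k (s + n, s) * (c i * ?M i)) =
      c i * (2 * real i * (real (n - i) + k) * (x1 ^ (s + i) * x2 ^ Suc (s + (n - i))) -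
       2 * real (n - i) * (real i + k) * (x1 ^ Suc (s + i) * x2 ^ (s + (n - i))))"
      unfolding j_def[symmetric] jack_eigenvalue2_def power_Suc X_def[symmetric] Y_def[symmetric]
        of_nat_add fst_conv snd_conv n
      by algebra
  qed simp
  finally show ?thesis .
qed

text \<open>
  Collecting equal monomials in the preceding expansion leaves the recurrence. The equation is
  given only off the diagonal, but at \<open>x2 = 1\<close> it says that a polynomial in \<open>x1\<close> vanishes at all
  points except possibly 0 and 1, so that its coefficients are zero.
\<close>
lemma eigen_equation_iff_jack_recurrence:
  "(\<forall>x1 x2. x1 \<noteq> x2 \<longrightarrow> jack_operator2 k (binary_form s n c) x1 x2 =
      jack_eigenvalue2 k (s + n, s) * binary_form s n c x1 x2) \<longleftrightarrow> jack_recurrence k n c"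
proof -
  define d where "d i = (real i + 1) * (real (n - Suc i) + k) * c (Suc i) -
      real (n - i) * (real i + k) * c i" for i
  have key: "(x1 - x2) * (jack_operator2 k (binary_form s n c) x1 x2
           - jack_eigenvalue2 k (s + n, s) * binary_form s n c x1 x2) =
         2 * x1 ^ Suc s * x2 ^ s * (\<Sum>i<n. d i * (x1 ^ i * x2 ^ (n - i)))"
    if "x1 \<noteq> x2" for x1 x2
  proof -
    have "(\<Sum>i\<le>n. c i * (2 * real i * (real (n - i) + k) * (x1 ^ (s + i) * x2 ^ Suc (s + (n - i))))) =
        (\<Sum>i<n. c (Suc i) * (2 * real (Suc i) * (real (n - Suc i) + k) *
           (x1 ^ (s + Suc i) * x2 ^ Suc (s + (n - Suc i)))))"
      by (subst sum.atMost_shift) simp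
    moreover have "(\<Sum>i\<le>n. c i * (2 * real (n - i) * (real i + k) * (x1 ^ Suc (s + i) * x2 ^ (s + (n - i))))) =
        (\<Sum>i<n. c i * (2 * real (n - i) * (real i + k) * (x1 ^ Suc (s + i) * x2 ^ (s + (n - i)))))"
      by (simp add: lessThan_Suc_atMost[symmetric])
    moreover have "c (Suc i) * (2 * real (Suc i) * (real (n - Suc i) + k) *
           (x1 ^ (s + Suc i) * x2 ^ Suc (s + (n - Suc i)))) -
        c i * (2 * real (n - i) * (real i + k) * (x1 ^ Suc (s + i) * x2 ^ (s + (n - i)))) =
        2 * x1 ^ Suc s * x2 ^ s * (d i * (x1 ^ i * x2 ^ (n - i)))" if "i \<in> {..<n}" for i
    proof -
      define m where "m = n - Suc i"
      then have m: "n - Suc i = m" "n - i = Suc m"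
        using that by auto
      have di: "d i = (real i + 1) * (real m + k) * c (Suc i) - (real m + 1) * (real i + k) * c i"
        by (simp add: d_def m add.commute)
      define X Y X' Y' where "X = x1 ^ s" and "Y = x2 ^ s" and "X' = x1 ^ i" and "Y' = x2 ^ m"
      show ?thesis
        unfolding m di power_add power_Suc add_Suc_right of_nat_Suc
          X_def[symmetric] Y_def[symmetric] X'_def[symmetric] Y'_def[symmetric]
        by (simp add: algebra_simps)
    qed
    ultimately show ?thesis
      unfolding jack_operator2_binary_form[OF that]
      by (simp only: right_diff_distrib[of "c _"] sum_subtractf sum_subtractf[symmetric] sum_distrib_left
        cong: sum.cong)
  qed
  have rec: "jack_recurrence k n c \<longleftrightarrow> (\<forall>i<n. d i = 0)"
  proof -
    have "jack_recurrence k n c \<longleftrightarrow> (\<forall>i<n. (real (n - Suc i) + 1) * (real i + k) * c i =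
        (real i + 1) * (real (n - Suc i) + k) * c (Suc i))"
      unfolding jack_recurrence_def
      by (metis add_diff_cancel_left' add_Suc less_add_Suc1 less_imp_Suc_add)
    also have "\<dots> \<longleftrightarrow> (\<forall>i<n. d i = 0)"
      by (auto simp: d_def of_nat_diff)
    finally show ?thesis .
  qed
  show ?thesis
  proof
    assume L: "\<forall>x1 x2. x1 \<noteq> x2 \<longrightarrow> jack_operator2 k (binary_form s n c) x1 x2 =
      jack_eigenvalue2 k (s + n, s) * binary_form s n c x1 x2"
    have z: "(\<Sum>i<n. d i * t ^ i) = 0" if "t \<noteq> 0" "t \<noteq> 1" for t
      using key[of t 1] L that by auto
    show "jack_recurrence k n c"
    proof (cases n)
      case (Suc m)
      have "\<not> finite {t. (\<Sum>i\<le>m. d i * t ^ i) = 0}"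
      proof
        assume "finite {t. (\<Sum>i\<le>m. d i * t ^ i) = 0}"
        moreover have "UNIV - {0, 1} \<subseteq> {t. (\<Sum>i\<le>m. d i * t ^ i) = 0}"
          using z by (auto simp: Suc lessThan_Suc_atMost)
        ultimately have "finite (UNIV - {0, 1 :: real})"
          by (rule finite_subset[rotated])
        then show False by (simp add: infinite_UNIV_char_0)
      qed
      then have "\<forall>i\<le>m. d i = 0"
        using polyfun_finite_roots[of d m] by blast
      then show ?thesis unfolding rec by (simp add: Suc less_Suc_eq_le)
    qed (simp add: jack_recurrence_def)
  next
    assume "jack_recurrence k n c"
    then have "\<And>i. i < n \<Longrightarrow> d i = 0" unfolding rec by auto
    then show "\<forall>x1 x2. x1 \<noteq> x2 \<longrightarrow> jack_operator2 k (binary_form s n c) x1 x2 =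
      jack_eigenvalue2 k (s + n, s) * binary_form s n c x1 x2"
      using key by fastforce
  qed
qed

section \<open>Explicit Jack polynomials\<close>

text \<open>
  The two indicators add up when \<open>2 * i = n\<close>, in accordance with the factor 2 in \<open>msym2\<close> on
  the diagonal.
\<close>
lemma msym2_binary_form:
  assumes "2 * i \<le> n"
  shows "msym2 (s + n - i, s + i) x1 x2 =
    binary_form s n (\<lambda>r. of_bool (r = i) + of_bool (r = n - i)) x1 x2"
proof -
  have "binary_form s n (\<lambda>r. of_bool (r = i) + of_bool (r = n - i)) x1 x2 =
      (\<Sum>r\<le>n. of_bool (r = i) * (x1 ^ (s + r) * x2 ^ (s + (n - r)))) +
      (\<Sum>r\<le>n. of_bool (r = n - i) * (x1 ^ (s + r) * x2 ^ (s + (n - r))))"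
    by (simp add: binary_form_def distrib_right sum.distrib)
  also have "\<dots> = x1 ^ (s + i) * x2 ^ (s + (n - i)) + x1 ^ (s + (n - i)) * x2 ^ (s + i)"
    using assms by (simp add: of_bool_def if_distrib[of "\<lambda>z. z * _"] sum.delta cong: if_cong)
  finally show ?thesis using assms by (simp add: msym2_def mult.commute)
qed

lemma dominated2_set_eq:
  "{m. is_partition2 m \<and> dominated2 m (s + n, s)} =
     (\<lambda>i. (s + n - i, s + i)) ` {i. 1 \<le> i \<and> 2 * i \<le> n}"
proof safe
  fix a b assume "is_partition2 (a, b)" "dominated2 (a, b) (s + n, s)"
  then have "b \<le> a" "a + b = s + n + s" "a \<le> s + n" "(a, b) \<noteq> (s + n, s)"
    by (auto simp: is_partition2_def dominated2_def size2_def)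
  then have "(a, b) = (s + n - (b - s), s + (b - s))" "1 \<le> b - s" "2 * (b - s) \<le> n"
    by auto
  then show "(a, b) \<in> (\<lambda>i. (s + n - i, s + i)) ` {i. 1 \<le> i \<and> 2 * i \<le> n}"
    by blast
qed (auto simp: is_partition2_def dominated2_def size2_def)

lemma msym2_sum_binary_form:
  "msym2 (s + n, s) x1 x2 +
     (\<Sum>m | is_partition2 m \<and> dominated2 m (s + n, s). a m * msym2 m x1 x2) =
   binary_form s n (\<lambda>r. \<Sum>i | 2 * i \<le> n. (if i = 0 then 1 else a (s + n - i, s + i)) *
     (of_bool (r = i) + of_bool (r = n - i))) x1 x2"
proof -
  define b where "b i = (if i = 0 then 1 else a (s + n - i, s + i))" for i
  have fin: "finite {i. 2 * i \<le> n}" by (rule finite_subset[of _ "{..n}"]) auto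
  have "(\<Sum>m | is_partition2 m \<and> dominated2 m (s + n, s). a m * msym2 m x1 x2) =
      (\<Sum>i | 1 \<le> i \<and> 2 * i \<le> n. b i * msym2 (s + n - i, s + i) x1 x2)"
    unfolding dominated2_set_eq
    by (subst sum.reindex) (auto simp: inj_on_def b_def intro!: sum.cong)
  moreover have "{i. 2 * i \<le> n} = insert 0 {i. 1 \<le> i \<and> 2 * i \<le> n}" by auto
  ultimately have "msym2 (s + n, s) x1 x2 +
      (\<Sum>m | is_partition2 m \<and> dominated2 m (s + n, s). a m * msym2 m x1 x2) =
      (\<Sum>i | 2 * i \<le> n. b i * msym2 (s + n - i, s + i) x1 x2)"
    using fin by (simp add: b_def)
  also have "\<dots> = (\<Sum>i | 2 * i \<le> n. \<Sum>r\<le>n. b i * ((of_bool (r = i) + of_bool (r = n - i)) *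
      (x1 ^ (s + r) * x2 ^ (s + (n - r)))))"
    by (rule sum.cong) (simp_all add: msym2_binary_form binary_form_def sum_distrib_left)
  also have "\<dots> = binary_form s n (\<lambda>r. \<Sum>i | 2 * i \<le> n. b i * (of_bool (r = i) + of_bool (r = n - i))) x1 x2"
    unfolding binary_form_def sum_distrib_right by (subst sum.swap) (simp add: mult.assoc)
  finally show ?thesis unfolding b_def .
qed

text \<open>
  A symmetric polynomial is a combination of monomial symmetric functions: each pair of equal
  coefficients is counted once, and a central coefficient is halved, because both indicators hit it.
\<close>
lemma palindrome_folding:
  fixes c :: "nat \<Rightarrow> real"
  assumes "\<And>r. r \<le> n \<Longrightarrow> c (n - r) = c r" and "r \<le> n"
  shows "(\<Sum>i | 2 * i \<le> n. (if 2 * i = n then c i / 2 else c i) * (of_bool (r = i) + of_bool (r = n - i))) = c r"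
proof -
  \<comment> \<open>Only the index in the lower half contributes.\<close>
  define m where "m = min r (n - r)"
  have fin: "finite {i. 2 * i \<le> n}" by (rule finite_subset[of _ "{..n}"]) auto
  have cm: "c m = c r" using assms by (auto simp: m_def min_def)
  have "(\<Sum>i | 2 * i \<le> n. (if 2 * i = n then c i / 2 else c i) * (of_bool (r = i) + of_bool (r = n - i))) =
      (\<Sum>i | 2 * i \<le> n. if i = m then c m else 0)"
  proof (rule sum.cong)
    fix i assume "i \<in> {i. 2 * i \<le> n}"
    then show "(if 2 * i = n then c i / 2 else c i) * (of_bool (r = i) + of_bool (r = n - i)) =
        (if i = m then c m else 0)"
      using \<open>r \<le> n\<close> by (auto simp: m_def min_def of_bool_def)
  qed simp
  also have "\<dots> = c m"
    using fin \<open>r \<le> n\<close> by (auto simp: sum.delta m_def)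
  finally show ?thesis using cm by simp
qed

text \<open>
  For positive \<open>x1\<close> and \<open>x2\<close> this is \<open>(x1 x2)\<close> to the power \<open>n / 2\<close> times the Gegenbauer polynomial of
  degree \<open>n\<close> and parameter \<open>k\<close> at \<open>(x1 + x2) / (2 sqrt (x1 x2))\<close>. The generating function in \<open>r\<close> is
  \<open>(1 - x1 r) (1 - x2 r)\<close> to the power \<open>-k\<close>.
\<close>
definition jack_form :: "real \<Rightarrow> nat \<Rightarrow> real \<Rightarrow> real \<Rightarrow> real" where
  "jack_form k n x1 x2 =
     (\<Sum>i\<le>n. neg_binom_coeff k i * neg_binom_coeff k (n - i) * (x1 ^ i * x2 ^ (n - i)))"

text \<open>
  The factor that gives the outermost coefficient its prescribed value: 1, or 2 if \<open>n = 0\<close>, where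
  the monomial symmetric function is twice a monomial.
\<close>
definition jack_norm :: "real \<Rightarrow> nat \<Rightarrow> real" where
  "jack_norm k n = (if n = 0 then 2 else 1) / neg_binom_coeff k n"

lemma jack_norm_pos: "k > 0 \<Longrightarrow> jack_norm k n > 0"
  by (simp add: jack_norm_def neg_binom_coeff_pos)

lemma binary_form_jack:
  "binary_form s n (\<lambda>i. C * (neg_binom_coeff k i * neg_binom_coeff k (n - i))) x1 x2 =
     C * (x1 * x2) ^ s * jack_form k n x1 x2"
  unfolding binary_form_def jack_form_def sum_distrib_left
  by (rule sum.cong) (simp_all only: power_add power_mult_distrib mult_ac)

text \<open>
  Existence and uniqueness at once: the dominance condition confines the exponents to
  \<open>s, \<dots>, s + n\<close>, the recurrence determines the coefficients from the outermost one, and conversely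
  its solution is symmetric, hence a combination of monomial symmetric functions.
\<close>
lemma is_jack2_iff:
  assumes "k > 0"
  shows "is_jack2 k (s + n, s) P \<longleftrightarrow>
    P = (\<lambda>x1 x2. jack_norm k n * (x1 * x2) ^ s * jack_form k n x1 x2)"
proof
  assume "is_jack2 k (s + n, s) P"
  then obtain a where
    P: "\<And>x1 x2. P x1 x2 = msym2 (s + n, s) x1 x2 +
      (\<Sum>m | is_partition2 m \<and> dominated2 m (s + n, s). a m * msym2 m x1 x2)"
    and eig: "\<forall>x1 x2. x1 \<noteq> x2 \<longrightarrow>
      jack_operator2 k P x1 x2 = jack_eigenvalue2 k (s + n, s) * P x1 x2"
    unfolding is_jack2_def by blast
  define c where "c r = (\<Sum>i | 2 * i \<le> n. (if i = 0 then 1 else a (s + n - i, s + i)) *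
     (of_bool (r = i) + of_bool (r = n - i)))" for r
  have P: "P = binary_form s n c"
    by (intro ext) (simp only: P msym2_sum_binary_form c_def[abs_def])
  have "jack_recurrence k n c"
    using eig unfolding P eigen_equation_iff_jack_recurrence .
  note rec = this
  have fin: "finite {i. 2 * i \<le> n}" by (rule finite_subset[of _ "{..n}"]) auto
  have "c 0 = (\<Sum>i | 2 * i \<le> n. if i = 0 then (if n = 0 then 2 else 1) else 0)"
    unfolding c_def by (rule sum.cong) auto
  also have "\<dots> = (if n = 0 then 2 else 1)"
    using fin by (simp add: sum.delta)
  finally have c0: "c 0 / neg_binom_coeff k n = jack_norm k n" by (simp add: jack_norm_def)
  have sol: "c i = jack_norm k n * (neg_binom_coeff k i * neg_binom_coeff k (n - i))" if "i \<le> n" for i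
    using jack_recurrence_solution[OF assms rec that] unfolding c0 .
  show "P = (\<lambda>x1 x2. jack_norm k n * (x1 * x2) ^ s * jack_form k n x1 x2)"
    unfolding P binary_form_jack[symmetric]
    by (intro ext) (simp add: binary_form_def sol)
next
  define c where "c i = jack_norm k n * (neg_binom_coeff k i * neg_binom_coeff k (n - i))" for i
  assume "P = (\<lambda>x1 x2. jack_norm k n * (x1 * x2) ^ s * jack_form k n x1 x2)"
  then have P: "P = binary_form s n c"
    unfolding binary_form_jack[symmetric] c_def[abs_def, symmetric] .
  have sym: "c (n - r) = c r" if "r \<le> n" for r
    using that by (simp add: c_def mult.commute)
  have c0: "c 0 = (if n = 0 then 2 else 1)"
    using neg_binom_coeff_pos[OF assms, of n] by (simp add: c_def jack_norm_def)
  define b where "b i = (if 2 * i = n then c i / 2 else c i)" for i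
  \<comment> \<open>The index \<open>i\<close> is recovered from the smaller part \<open>s + i\<close> of the partition.\<close>
  define a where "a m = b (snd m - s)" for m :: "nat \<times> nat"
  have "b 0 = 1" using c0 by (simp add: b_def)
  then have b: "(if i = 0 then 1 else a (s + n - i, s + i)) = b i" for i
    by (simp add: a_def)
  have "P x1 x2 = msym2 (s + n, s) x1 x2 +
      (\<Sum>m | is_partition2 m \<and> dominated2 m (s + n, s). a m * msym2 m x1 x2)" for x1 x2
    unfolding msym2_sum_binary_form b P binary_form_def
    by (rule sum.cong) (simp_all add: b_def palindrome_folding[of n c, OF sym])
  moreover have "jack_recurrence k n c"
    unfolding c_def[abs_def] by (rule jack_recurrence_neg_binom_coeff)
  ultimately show "is_jack2 k (s + n, s) P"
    unfolding is_jack2_def P unfolding eigen_equation_iff_jack_recurrence by blast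
qed

lemma jack2_eq:
  assumes "k > 0"
  shows "jack2 k (s + n, s) x1 x2 = jack_norm k n * (x1 * x2) ^ s * jack_form k n x1 x2"
  unfolding jack2_def is_jack2_iff[OF assms] by simp

lemma jack_form_pos: "k > 0 \<Longrightarrow> jack_form k n 1 1 > 0"
  unfolding jack_form_def by (intro sum_pos) (auto intro: mult_pos_pos neg_binom_coeff_pos)

section \<open>Coefficients of powers of \<open>1 - A s - B t + q s t\<close>\<close>

definition product_coeff_term :: "real \<Rightarrow> real \<Rightarrow> nat \<Rightarrow> nat \<Rightarrow> real \<Rightarrow> real \<Rightarrow> nat \<Rightarrow> real" where
  "product_coeff_term k q a b A B j = (if j \<le> a \<and> j \<le> b
     then (- q) ^ j * pochhammer k (a + b - j) / (fact j * fact (a - j) * fact (b - j))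
       * A ^ (a - j) * B ^ (b - j)
     else 0)"

text \<open>
  The coefficient of \<open>s\<^sup>a t\<^sup>b\<close> in \<open>1 - A s - B t + q s t\<close> to the power \<open>-k\<close>, obtained from the
  multinomial expansion in which \<open>j\<close> counts the factors \<open>q s t\<close>.
\<close>
definition product_coeff :: "real \<Rightarrow> real \<Rightarrow> nat \<Rightarrow> nat \<Rightarrow> real \<Rightarrow> real \<Rightarrow> real" where
  "product_coeff k q a b A B = (\<Sum>j\<le>a + b. product_coeff_term k q a b A B j)"

text \<open>
  The partial derivatives in \<open>A\<close> and \<open>B\<close>: differentiating the generating function multiplies it by
  \<open>k s\<close> or \<open>k t\<close> and raises \<open>k\<close> by one.
\<close>
definition product_coeff_dA :: "real \<Rightarrow> real \<Rightarrow> nat \<Rightarrow> nat \<Rightarrow> real \<Rightarrow> real \<Rightarrow> real" where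
  "product_coeff_dA k q a b A B = (case a of 0 \<Rightarrow> 0 | Suc a' \<Rightarrow> k * product_coeff (k + 1) q a' b A B)"

definition product_coeff_dB :: "real \<Rightarrow> real \<Rightarrow> nat \<Rightarrow> nat \<Rightarrow> real \<Rightarrow> real \<Rightarrow> real" where
  "product_coeff_dB k q a b A B = (case b of 0 \<Rightarrow> 0 | Suc b' \<Rightarrow> k * product_coeff (k + 1) q a b' A B)"

lemma product_coeff_swap: "product_coeff k q a b A B = product_coeff k q b a B A"
  unfolding product_coeff_def product_coeff_term_def by (rule sum.cong) (auto simp: add.commute mult_ac)

lemma product_coeff_dA_swap: "product_coeff_dA k q a b A B = product_coeff_dB k q b a B A"
  unfolding product_coeff_dA_def product_coeff_dB_def by (simp add: product_coeff_swap split: nat.split)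

lemma product_coeff_cutoff:
  assumes "a \<le> N \<or> b \<le> N"
  shows "product_coeff k q a b A B = (\<Sum>j\<le>N. product_coeff_term k q a b A B j)"
  unfolding product_coeff_def by (rule sum.mono_neutral_cong) (use assms in \<open>auto simp: product_coeff_term_def\<close>)

lemma pochhammer_shift: "k * pochhammer (k + 1) m = pochhammer k (Suc m)" for k :: real
  by (simp add: pochhammer_rec)

lemma product_coeff_0_left: "product_coeff k q 0 b A B = neg_binom_coeff k b * B ^ b"
  by (subst product_coeff_cutoff[of _ 0]) (simp_all add: product_coeff_term_def neg_binom_coeff_def)

lemma fact_Suc_obtain:
  obtains c :: real where "real (Suc m) = c" "fact (Suc m) = c * fact m" "c \<noteq> 0"
proof (rule that)
  show "fact (Suc m) = real (Suc m) * fact m" by (rule fact_Suc)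
qed simp_all

text \<open>
  All terms occurring in the contiguity relation are multiples of a common one, \<open>W\<close>. The parameters
  \<open>i\<close> and \<open>l\<close> are the exponents of \<open>A\<close> and \<open>B\<close>, so that no subtraction remains.
\<close>
lemma product_coeff_term_shift:
  fixes k q A B :: real and i l j :: nat
  defines "W \<equiv> (- q) ^ j * pochhammer k (i + l + j) / (fact j * fact i * fact l) * A ^ i * B ^ l"
  shows "product_coeff_term k q (i + j) (l + j) A B j = W"
    and "l = Suc l' \<Longrightarrow> B * (k * product_coeff_term (k + 1) q (i + j) (l' + j) A B j) = real l * W"
    and "i = Suc i' \<Longrightarrow> l = Suc l' \<Longrightarrow>
      A * B * (k * (k + 1) * product_coeff_term (k + 2) q (i' + j) (l' + j) A B j) = real i * real l * W"
    and "j = Suc j' \<Longrightarrow>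
      - q * (k * (k + 1) * product_coeff_term (k + 2) q (i + j') (l + j') A B j') = real j * (k + real (i + l + j)) * W"
proof -
  have 1: "k * (k + 1) * pochhammer (k + 2) m = pochhammer k (Suc (Suc m))" for m
  proof -
    have "(k + 1) * pochhammer (k + 2) m = pochhammer (k + 1) (Suc m)"
      using pochhammer_shift[of "k + 1" m] by (simp only: add.assoc one_add_one)
    then show ?thesis by (simp only: mult.assoc pochhammer_shift)
  qed
  show "product_coeff_term k q (i + j) (l + j) A B j = W"
    by (simp add: product_coeff_term_def W_def add.assoc)
  show "B * (k * product_coeff_term (k + 1) q (i + j) (l' + j) A B j) = real l * W" if "l = Suc l'"
  proof -
    have "B * (k * product_coeff_term (k + 1) q (i + j) (l' + j) A B j) =
        (- q) ^ j * (k * pochhammer (k + 1) (i + l' + j)) / (fact j * fact i * fact l') * A ^ i * B ^ l"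
      by (simp add: product_coeff_term_def that add.assoc)
    also have "\<dots> = real l * W"
    proof -
      obtain cl where cl: "real (Suc l') = cl" "fact (Suc l') = cl * fact l'" "cl \<noteq> 0"
        by (rule fact_Suc_obtain)
      show ?thesis
        unfolding pochhammer_shift W_def that cl(1,2) using cl(3) by (simp add: field_simps del: pochhammer_Suc fact_Suc of_nat_Suc)
    qed
    finally show ?thesis .
  qed
  show "A * B * (k * (k + 1) * product_coeff_term (k + 2) q (i' + j) (l' + j) A B j) = real i * real l * W"
    if "i = Suc i'" "l = Suc l'"
  proof -
    have "A * B * (k * (k + 1) * product_coeff_term (k + 2) q (i' + j) (l' + j) A B j) =
        (- q) ^ j * (k * (k + 1) * pochhammer (k + 2) (i' + l' + j)) / (fact j * fact i' * fact l') * A ^ i * B ^ l"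
      by (simp add: product_coeff_term_def that add.assoc)
    also have "\<dots> = real i * real l * W"
    proof -
      obtain ci where ci: "real (Suc i') = ci" "fact (Suc i') = ci * fact i'" "ci \<noteq> 0"
        by (rule fact_Suc_obtain)
      obtain cl where cl: "real (Suc l') = cl" "fact (Suc l') = cl * fact l'" "cl \<noteq> 0"
        by (rule fact_Suc_obtain)
      show ?thesis
        unfolding 1 W_def that ci(1,2) cl(1,2) using ci(3) cl(3) by (simp add: field_simps del: pochhammer_Suc fact_Suc of_nat_Suc)
    qed
    finally show ?thesis .
  qed
  show "- q * (k * (k + 1) * product_coeff_term (k + 2) q (i + j') (l + j') A B j') = real j * (k + real (i + l + j)) * W"
    if "j = Suc j'"
  proof -
    have "- q * (k * (k + 1) * product_coeff_term (k + 2) q (i + j') (l + j') A B j') =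
        (- q) ^ j * (k * (k + 1) * pochhammer (k + 2) (i + l + j')) / (fact j' * fact i * fact l) * A ^ i * B ^ l"
      by (simp add: product_coeff_term_def that add.assoc)
    also have "k * (k + 1) * pochhammer (k + 2) (i + l + j') = (k + real (i + l + j)) * pochhammer k (i + l + j)"
      unfolding 1 by (simp add: that pochhammer_Suc mult.commute)
    also have "(- q) ^ j * ((k + real (i + l + j)) * pochhammer k (i + l + j)) / (fact j' * fact i * fact l) * A ^ i * B ^ l
        = real j * (k + real (i + l + j)) * W"
    proof -
      obtain cj where cj: "real (Suc j') = cj" "fact (Suc j') = cj * fact j'" "cj \<noteq> 0"
        by (rule fact_Suc_obtain)
      show ?thesis
        unfolding W_def that cj(1,2) using cj(3) by (simp add: field_simps del: pochhammer_Suc fact_Suc of_nat_Suc)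
    qed
    finally show ?thesis .
  qed
qed

text \<open>
  Comparison of the terms with \<open>j\<close> factors \<open>q\<close> on both sides. In the notation of the previous lemma,
  with \<open>a = i + j\<close> and \<open>b + 1 = l + j\<close>, the claim for one term is
  \<open>(b + 1) (a + k) = i l + j (k + i + l + j) + k l\<close>.
\<close>
lemma product_coeff_contiguity:
  "(real b + 1) * (real a + k) * product_coeff k q a (Suc b) A B =
     (A * B - q) * k * product_coeff_dA (k + 1) q a b A B + k * k * B * product_coeff (k + 1) q a b A B"
proof (cases a)
  case 0
  have "(real b + 1) * (real a + k) * product_coeff k q a (Suc b) A B =
      k * ((real b + 1) * neg_binom_coeff k (Suc b)) * B ^ Suc b"
    unfolding 0 product_coeff_0_left by simp
  also have "\<dots> = k * k * B * (neg_binom_coeff (k + 1) b * B ^ b)"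
  proof -
    have "(real b + k) * pochhammer k b = k * pochhammer (k + 1) b"
      unfolding pochhammer_shift by (simp add: pochhammer_Suc algebra_simps)
    then have "(real b + k) * neg_binom_coeff k b = k * neg_binom_coeff (k + 1) b"
      by (simp add: neg_binom_coeff_def)
    then show ?thesis unfolding neg_binom_coeff_Suc by simp
  qed
  finally show ?thesis unfolding 0 product_coeff_0_left by (simp add: product_coeff_dA_def)
next
  case (Suc a')
  let ?T = "product_coeff_term (k + 2) q a' b A B"
  let ?t = "\<lambda>j. A * B * (k * (k + 1) * ?T j)
       + (case j of 0 \<Rightarrow> 0 | Suc j' \<Rightarrow> - q * (k * (k + 1) * ?T j'))
       + k * (B * (k * product_coeff_term (k + 1) q a b A B j))"
  have termwise: "(real b + 1) * (real a + k) * product_coeff_term k q a (Suc b) A B j = ?t j" for j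
  proof (cases "j \<le> a \<and> j \<le> Suc b")
    case False
    then show ?thesis by (auto simp: product_coeff_term_def Suc split: nat.split)
  next
    case True
    then obtain i l where i: "a = i + j" and l: "Suc b = l + j"
      by (metis le_add_diff_inverse2)
    define W where "W = product_coeff_term k q (i + j) (l + j) A B j"
    note W = W_def[unfolded product_coeff_term_shift(1)]
    have "A * B * (k * (k + 1) * ?T j) = real i * real l * W"
    proof (cases "i = 0 \<or> l = 0")
      case True
      then show ?thesis using i l Suc by (auto simp: product_coeff_term_def)
    next
      case False
      then obtain i' l' where s: "i = Suc i'" "l = Suc l'" by (metis not0_implies_Suc)
      with i l Suc have "a' = i' + j" "b = l' + j" by auto
      then show ?thesis using product_coeff_term_shift(3)[OF s] W by simp
    qed
    moreover have "(case j of 0 \<Rightarrow> 0 | Suc j' \<Rightarrow> - q * (k * (k + 1) * ?T j')) =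
        real j * (k + real (i + l + j)) * W"
    proof (cases j)
      case (Suc j')
      with i l \<open>a = Suc a'\<close> have "a' = i + j'" "b = l + j'" by auto
      then show ?thesis using product_coeff_term_shift(4)[OF Suc] W Suc by simp
    qed simp
    moreover have "B * (k * product_coeff_term (k + 1) q a b A B j) = real l * W"
    proof (cases l)
      case 0
      then show ?thesis using l by (auto simp: product_coeff_term_def)
    next
      case (Suc l')
      with l have "b = l' + j" by auto
      then show ?thesis using product_coeff_term_shift(2)[OF Suc] W i by simp
    qed
    moreover have "product_coeff_term k q a (Suc b) A B j = W" unfolding i l W_def ..
    moreover have "real a = real i + real j" "real b + 1 = real l + real j"
      using i l by linarith+
    ultimately show ?thesis by (simp add: algebra_simps)
  qed
  have "(real b + 1) * (real a + k) * product_coeff k q a (Suc b) A B = (\<Sum>j\<le>Suc a'. ?t j)"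
    by (subst product_coeff_cutoff[of _ "Suc a'"]) (simp_all only: Suc sum_distrib_left termwise[unfolded Suc], simp)
  also have "\<dots> = A * B * (k * (k + 1) * (\<Sum>j\<le>Suc a'. ?T j))
      + - q * (k * (k + 1) * (\<Sum>j\<le>a'. ?T j)) + k * (B * (k * (\<Sum>j\<le>Suc a'. product_coeff_term (k + 1) q a b A B j)))"
    unfolding sum.distrib sum_distrib_left[symmetric] sum.atMost_Suc_shift[of "case_nat 0 _"]
    by (simp add: sum_distrib_left)
  also have "(\<Sum>j\<le>Suc a'. ?T j) = product_coeff (k + 2) q a' b A B" by (rule product_coeff_cutoff[symmetric]) simp
  also have "(\<Sum>j\<le>a'. ?T j) = product_coeff (k + 2) q a' b A B" by (rule product_coeff_cutoff[symmetric]) simp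
  also have "(\<Sum>j\<le>Suc a'. product_coeff_term (k + 1) q a b A B j) = product_coeff (k + 1) q a b A B"
    by (rule product_coeff_cutoff[symmetric]) (simp add: Suc)
  finally show ?thesis by (simp add: product_coeff_dA_def Suc algebra_simps)
qed

lemma product_coeff_contiguity':
  "(real a + 1) * (real b + k) * product_coeff k q (Suc a) b A B =
     (A * B - q) * k * product_coeff_dB (k + 1) q a b A B + k * k * A * product_coeff (k + 1) q a b A B"
  using product_coeff_contiguity[of a b k q B A]
  by (simp add: product_coeff_swap[of k q "Suc a" b] product_coeff_dA_swap product_coeff_swap[of "k + 1" q a b] mult.commute[of B A])

lemma product_coeff_term_deriv:
  assumes "(A has_field_derivative dA) (at u)" and "(B has_field_derivative dB) (at u)"
  shows "((\<lambda>u. product_coeff_term k q a b (A u) (B u) j) has_field_derivative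
    (case a of 0 \<Rightarrow> 0 | Suc a' \<Rightarrow> k * product_coeff_term (k + 1) q a' b (A u) (B u) j) * dA
    + (case b of 0 \<Rightarrow> 0 | Suc b' \<Rightarrow> k * product_coeff_term (k + 1) q a b' (A u) (B u) j) * dB) (at u)"
proof (cases "j \<le> a \<and> j \<le> b")
  case False
  then have "product_coeff_term k q a b A B j = 0" "(case a of 0 \<Rightarrow> 0 | Suc a' \<Rightarrow> k * product_coeff_term (k + 1) q a' b A B j) = 0"
    "(case b of 0 \<Rightarrow> 0 | Suc b' \<Rightarrow> k * product_coeff_term (k + 1) q a b' A B j) = 0" for A B
    by (auto simp: product_coeff_term_def split: nat.split)
  then show ?thesis by simp
next
  case True
  then obtain i l where i: "a = i + j" and l: "b = l + j"
    by (metis le_add_diff_inverse2)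
  let ?c = "(- q) ^ j * pochhammer k (i + l + j) / (fact j * fact i * fact l)"
  have dA: "(case a of 0 \<Rightarrow> 0 | Suc a' \<Rightarrow> k * product_coeff_term (k + 1) q a' b (A u) (B u) j) =
      ?c * (real i * A u ^ (i - 1)) * B u ^ l"
  proof (cases i)
    case 0
    then show ?thesis by (auto simp: i product_coeff_term_def split: nat.split)
  next
    case (Suc i')
    have "k * product_coeff_term (k + 1) q (i' + j) b (A u) (B u) j =
      (- q) ^ j * (k * pochhammer (k + 1) (i' + l + j)) / (fact j * fact i' * fact l) * A u ^ i' * B u ^ l"
      by (simp add: product_coeff_term_def l add.assoc)
    also have "\<dots> = ?c * (real i * A u ^ (i - 1)) * B u ^ l"
    proof -
      obtain ci where ci: "real (Suc i') = ci" "fact (Suc i') = ci * fact i'" "ci \<noteq> 0"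
        by (rule fact_Suc_obtain)
      show ?thesis
        unfolding pochhammer_shift Suc ci(1,2) using ci(3) by (simp add: field_simps del: pochhammer_Suc fact_Suc of_nat_Suc)
    qed
    finally show ?thesis by (simp add: i Suc)
  qed
  have dB: "(case b of 0 \<Rightarrow> 0 | Suc b' \<Rightarrow> k * product_coeff_term (k + 1) q a b' (A u) (B u) j) =
      ?c * A u ^ i * (real l * B u ^ (l - 1))"
  proof (cases l)
    case 0
    then show ?thesis by (auto simp: l product_coeff_term_def split: nat.split)
  next
    case (Suc l')
    have "k * product_coeff_term (k + 1) q a (l' + j) (A u) (B u) j =
      (- q) ^ j * (k * pochhammer (k + 1) (i + l' + j)) / (fact j * fact i * fact l') * A u ^ i * B u ^ l'"
      by (simp add: product_coeff_term_def i add.assoc)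
    also have "\<dots> = ?c * A u ^ i * (real l * B u ^ (l - 1))"
    proof -
      obtain cl where cl: "real (Suc l') = cl" "fact (Suc l') = cl * fact l'" "cl \<noteq> 0"
        by (rule fact_Suc_obtain)
      show ?thesis
        unfolding pochhammer_shift Suc cl(1,2) using cl(3) by (simp add: field_simps del: pochhammer_Suc fact_Suc of_nat_Suc)
    qed
    finally show ?thesis by (simp add: l Suc)
  qed
  have "product_coeff_term k q a b (A u) (B u) j = ?c * A u ^ i * B u ^ l" for u
    by (simp add: product_coeff_term_def i l add.assoc)
  moreover have "((\<lambda>u. c * A u ^ i * B u ^ l) has_field_derivative
      c * (real i * A u ^ (i - 1)) * B u ^ l * dA + c * A u ^ i * (real l * B u ^ (l - 1)) * dB) (at u)" for c
    by (rule derivative_eq_intros assms refl)+ (simp add: algebra_simps)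
  ultimately show ?thesis
    unfolding dA dB by (simp only:)
qed

lemma product_coeff_deriv:
  assumes "(A has_field_derivative dA) (at u)" and "(B has_field_derivative dB) (at u)"
  shows "((\<lambda>u. product_coeff k q a b (A u) (B u)) has_field_derivative
    product_coeff_dA k q a b (A u) (B u) * dA + product_coeff_dB k q a b (A u) (B u) * dB) (at u)"
proof -
  have 1: "product_coeff_dA k q a b A B = (\<Sum>j\<le>a + b. case a of 0 \<Rightarrow> 0 | Suc a' \<Rightarrow> k * product_coeff_term (k + 1) q a' b A B j)" for A B
    by (cases a) (simp_all add: product_coeff_dA_def product_coeff_cutoff[of _ "a + b"] sum_distrib_left del: sum.atMost_Suc)
  have 2: "product_coeff_dB k q a b A B = (\<Sum>j\<le>a + b. case b of 0 \<Rightarrow> 0 | Suc b' \<Rightarrow> k * product_coeff_term (k + 1) q a b' A B j)" for A B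
    by (cases b) (simp_all add: product_coeff_dB_def product_coeff_cutoff[of _ "a + b"] sum_distrib_left del: sum.atMost_Suc)
  show ?thesis
    unfolding 1 2 sum_distrib_right sum.distrib[symmetric] product_coeff_def
    by (rule DERIV_sum) (rule product_coeff_term_deriv[OF assms])
qed

text \<open>
  Once its two variables are equated, the generating function depends on \<open>A\<close> and \<open>B\<close> only
  through \<open>A + B\<close>. In terms of coefficients, along the
  line \<open>(A + s, B - s)\<close> the derivative of the sum telescopes to zero.
\<close>
lemma product_coeff_sum_cong:
  assumes "A + B = A' + B'"
  shows "(\<Sum>a\<le>n. product_coeff k q a (n - a) A B) = (\<Sum>a\<le>n. product_coeff k q a (n - a) A' B')"
proof -
  let ?f = "\<lambda>s. \<Sum>a\<le>n. product_coeff k q a (n - a) (A + s) (B - s)"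
  have "(?f has_field_derivative 0) (at s)" for s
  proof -
    have "(?f has_field_derivative (\<Sum>a\<le>n. product_coeff_dA k q a (n - a) (A + s) (B - s) * 1 +
        product_coeff_dB k q a (n - a) (A + s) (B - s) * (- 1))) (at s)"
      by (rule DERIV_sum, rule product_coeff_deriv) (auto intro!: derivative_eq_intros)
    also have "(\<Sum>a\<le>n. product_coeff_dA k q a (n - a) (A + s) (B - s) * 1 +
        product_coeff_dB k q a (n - a) (A + s) (B - s) * (- 1)) = 0"
    proof (cases n)
      case 0
      then show ?thesis by (simp add: product_coeff_dA_def product_coeff_dB_def)
    next
      case (Suc m)
      let ?c = "\<lambda>a. k * product_coeff (k + 1) q a (m - a) (A + s) (B - s)"
      have "(\<Sum>a\<le>n. product_coeff_dA k q a (n - a) (A + s) (B - s)) = (\<Sum>a\<le>m. ?c a)"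
        unfolding Suc sum.atMost_Suc_shift by (simp add: product_coeff_dA_def)
      moreover have "(\<Sum>a\<le>n. product_coeff_dB k q a (n - a) (A + s) (B - s)) = (\<Sum>a\<le>m. ?c a)"
        unfolding Suc by (simp add: product_coeff_dB_def Suc_diff_le)
      ultimately show ?thesis by (simp add: sum_subtractf)
    qed
    finally show ?thesis .
  qed
  then have "?f (A' - A) = ?f 0"
    by (intro DERIV_isconst_all) blast
  moreover have "B - (A' - A) = B'" using assms by simp
  ultimately show ?thesis by simp
qed

lemma product_coeff_scale: "product_coeff k (s * t * q) a b (s * A) (t * B) = s ^ a * t ^ b * product_coeff k q a b A B"
  unfolding product_coeff_def sum_distrib_left
proof (rule sum.cong)
  fix j
  show "product_coeff_term k (s * t * q) a b (s * A) (t * B) j = s ^ a * t ^ b * product_coeff_term k q a b A B j"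
  proof (cases "j \<le> a \<and> j \<le> b")
    case True
    then obtain i l where i: "a = i + j" and l: "b = l + j"
      by (metis le_add_diff_inverse2)
    show ?thesis
      by (simp add: product_coeff_term_def i l power_add power_mult_distrib power_minus[of "s * t * q"] power_minus[of q])
  qed (auto simp: product_coeff_term_def)
qed simp

text \<open>
  For \<open>q = A B\<close> the base \<open>1 - A s - B t + q s t\<close> is \<open>(1 - A s) (1 - B t)\<close>. Instead of multiplying
  series, one observes that for \<open>A = B = q = 1\<close> the derivative terms in both contiguity relations
  vanish, which leaves the recurrence for Jack coefficients.
\<close>
lemma product_coeff_split: "product_coeff k (A * B) a b A B = neg_binom_coeff k a * neg_binom_coeff k b * (A ^ a * B ^ b)"
  if "k > 0"
proof -
  define n where "n = a + b"
  have "jack_recurrence k n (\<lambda>i. product_coeff k 1 i (n - i) 1 1)"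
    unfolding jack_recurrence_def
  proof (intro allI impI)
    fix i j :: nat assume "Suc (i + j) = n"
    then have "n - i = Suc j" "n - Suc i = j" by auto
    then show "(real j + 1) * (real i + k) * product_coeff k 1 i (n - i) 1 1 =
        (real i + 1) * (real j + k) * product_coeff k 1 (Suc i) (n - Suc i) 1 1"
      unfolding product_coeff_contiguity' by (simp add: product_coeff_contiguity product_coeff_contiguity')
  qed
  from jack_recurrence_solution[OF that this, of a]
  have "product_coeff k 1 a b 1 1 = neg_binom_coeff k a * neg_binom_coeff k b"
    using neg_binom_coeff_pos[OF that, of n] by (simp add: product_coeff_0_left n_def)
  then show ?thesis
    using product_coeff_scale[of k A B 1 a b 1 1] by simp
qed

lemma jack_form_eq_product_coeff_sum:
  assumes "k > 0"
  shows "jack_form k n A B = (\<Sum>a\<le>n. product_coeff k (A * B) a (n - a) A B)"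
  unfolding jack_form_def product_coeff_split[OF assms] ..

text \<open>
  Replacing \<open>z1\<close> and \<open>z2\<close> by \<open>x1 A\<close> and \<open>x2 B\<close> changes neither their sum nor, in \<open>product_coeff\<close>, the
  product parameter; then the powers of \<open>x1\<close> and \<open>x2\<close> come out by homogeneity. Applied with
  \<open>x1 = x2 = 1\<close> it also shows that the coefficients sum to a value of the form itself.
\<close>
lemma jack_form_product_expansion:
  assumes "k > 0" and "z1 + z2 = x1 * A + x2 * B" and "z1 * z2 = x1 * x2 * q"
  shows "jack_form k n z1 z2 = (\<Sum>a\<le>n. product_coeff k q a (n - a) A B * (x1 ^ a * x2 ^ (n - a)))"
proof -
  have "jack_form k n z1 z2 = (\<Sum>a\<le>n. product_coeff k (z1 * z2) a (n - a) z1 z2)"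
    by (rule jack_form_eq_product_coeff_sum[OF assms(1)])
  also have "\<dots> = (\<Sum>a\<le>n. product_coeff k (z1 * z2) a (n - a) (x1 * A) (x2 * B))"
    by (rule product_coeff_sum_cong[OF assms(2)])
  also have "\<dots> = (\<Sum>a\<le>n. product_coeff k q a (n - a) A B * (x1 ^ a * x2 ^ (n - a)))"
    unfolding assms(3) product_coeff_scale by (simp add: mult.commute)
  finally show ?thesis .
qed

section \<open>The weight function\<close>

text \<open>
  The substitution \<open>u = 2 t - 1\<close> gives a Beta integral, and Legendre's duplication formula
  evaluates \<open>Beta k k\<close> in the required form.
\<close>
lemma weight_has_integral:
  fixes k :: real
  assumes "k > 0"
  shows "((\<lambda>u. (1 - u\<^sup>2) powr (k - 1)) has_integral Gamma k * sqrt pi / Gamma (k + 1 / 2)) {-1..1}"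
proof -
  have dup: "Gamma k * Gamma (k + 1 / 2) = 2 powr (1 - 2 * k) * sqrt pi * Gamma (2 * k)"
  proof -
    let ?z = "complex_of_real k"
    have "?z \<notin> \<int>\<^sub>\<le>\<^sub>0" "?z + 1 / 2 \<notin> \<int>\<^sub>\<le>\<^sub>0"
      using assms by (auto elim!: nonpos_Ints_cases simp: complex_eq_iff)
    from Gamma_legendre_duplication[OF this]
    have "complex_of_real (Gamma k * Gamma (k + 1 / 2)) =
        complex_of_real (exp ((1 - 2 * k) * ln 2) * sqrt pi * Gamma (2 * k))"
      by (simp flip: Gamma_complex_of_real exp_of_real)
    then show ?thesis
      by (simp only: of_real_eq_iff) (simp add: powr_def)
  qed
  have "((\<lambda>u. ((1 / 2) *\<^sub>R u + 1 / 2) powr (k - 1) * (1 - ((1 / 2) *\<^sub>R u + 1 / 2)) powr (k - 1))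
      has_integral Beta k k /\<^sub>R (1 / 2) ^ DIM(real))
      (cbox ((0 - 1 / 2) /\<^sub>R (1 / 2)) ((1 - 1 / 2) /\<^sub>R (1 / 2)))"
    by (rule has_integral_affinity'[where m = "1 / 2" and c = "1 / 2"])
      (use has_integral_Beta_real[OF assms assms] in simp_all)
  then have "((\<lambda>u. 4 powr (k - 1) * ((u / 2 + 1 / 2) powr (k - 1) * (1 - (u / 2 + 1 / 2)) powr (k - 1)))
      has_integral 4 powr (k - 1) * (2 * Beta k k)) {-1..1}"
    by (intro has_integral_mult_right) simp
  then have "((\<lambda>u. (1 - u\<^sup>2) powr (k - 1)) has_integral 4 powr (k - 1) * (2 * Beta k k)) {-1..1}"
  proof (rule has_integral_eq[rotated])
    fix u :: real assume "u \<in> {-1..1}"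
    then have "4 powr (k - 1) * ((u / 2 + 1 / 2) powr (k - 1) * (1 - (u / 2 + 1 / 2)) powr (k - 1)) =
        (4 * ((u / 2 + 1 / 2) * (1 - (u / 2 + 1 / 2)))) powr (k - 1)"
      by (simp add: powr_mult)
    also have "4 * ((u / 2 + 1 / 2) * (1 - (u / 2 + 1 / 2))) = 1 - u\<^sup>2"
      by (simp add: field_simps power2_eq_square)
    finally show "4 powr (k - 1) * ((u / 2 + 1 / 2) powr (k - 1) * (1 - (u / 2 + 1 / 2)) powr (k - 1)) =
        (1 - u\<^sup>2) powr (k - 1)" .
  qed
  also have "4 powr (k - 1) * (2 * Beta k k) = Gamma k * sqrt pi / Gamma (k + 1 / 2)"
  proof -
    have G: "Gamma k > 0" "Gamma (k + 1 / 2) > 0" "Gamma (2 * k) > 0"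
      using assms by (auto intro!: Gamma_real_pos)
    have p: "4 powr (k - 1) * 2 * 2 powr (1 - 2 * k) = (1 :: real)"
    proof -
      have "(4 :: real) powr (k - 1) = 2 powr (2 * (k - 1))"
        using powr_powr[of 2 2 "k - 1", symmetric] by simp
      then have "4 powr (k - 1) * 2 * 2 powr (1 - 2 * k) = (2 powr (2 * (k - 1)) * 2 powr 1 * 2 powr (1 - 2 * k) :: real)"
        by simp
      also have "\<dots> = 1" by (simp only: powr_add[symmetric]) simp
      finally show ?thesis .
    qed
    have "Beta k k * Gamma (2 * k) = Gamma k * Gamma k"
      using G by (simp only: Beta_def mult_2) simp
    then have "(4 powr (k - 1) * (2 * Beta k k) * Gamma (k + 1 / 2)) * (Gamma k * Gamma (2 * k)) =
        4 powr (k - 1) * 2 * (Gamma k * Gamma k) * (Gamma k * Gamma (k + 1 / 2))"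
      by algebra
    also have "\<dots> = (4 powr (k - 1) * 2 * 2 powr (1 - 2 * k)) * (Gamma k * sqrt pi) * (Gamma k * Gamma (2 * k))"
      unfolding dup by (simp only: mult_ac)
    finally have "4 powr (k - 1) * (2 * Beta k k) * Gamma (k + 1 / 2) = Gamma k * sqrt pi"
      unfolding p using G by (simp only: mult_cancel_right) simp
    then show ?thesis using G(2) by (simp only: eq_divide_eq) simp
  qed
  finally show ?thesis .
qed

text \<open>
  For \<open>k < 1\<close> the weight is unbounded near the endpoints, so integrability comes from its finite
  integral together with the boundedness of \<open>f\<close>.
\<close>
lemma set_integrable_weight:
  fixes k :: real and f :: "real \<Rightarrow> real"
  assumes "k > 0" and f: "continuous_on UNIV f"
  shows "set_integrable lborel {-1..1} (\<lambda>u. f u * (1 - u\<^sup>2) powr (k - 1))"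
proof -
  let ?w = "\<lambda>u :: real. (1 - u\<^sup>2) powr (k - 1)"
  have [measurable]: "f \<in> borel_measurable borel"
    using f by (rule borel_measurable_continuous_onI)
  have "?w absolutely_integrable_on {-1..1}"
    using weight_has_integral[OF assms(1)]
    by (intro nonnegative_absolutely_integrable_1) auto
  then have w: "set_integrable lborel {-1..1} ?w"
    unfolding set_integrable_def by (subst (asm) integrable_completion) measurable
  have "bounded (f ` {-1..1})"
    by (intro compact_imp_bounded compact_continuous_image continuous_on_subset[OF f]) auto
  then obtain C where C: "\<forall>u\<in>{-1..1}. \<bar>f u\<bar> \<le> C"
    by (auto simp: bounded_iff)
  show ?thesis
  proof (rule set_integrable_bound)
    show "set_integrable lborel {-1..1} (\<lambda>u. C * ?w u)"
      using w by simp
    show "set_borel_measurable lborel {-1..1} (\<lambda>u. f u * ?w u)"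
      unfolding set_borel_measurable_def by measurable
    show "AE u in lborel. u \<in> {-1..1} \<longrightarrow> norm (f u * ?w u) \<le> norm (C * ?w u)"
    proof (intro AE_I2 impI)
      fix u :: real assume "u \<in> {-1..1}"
      with C have "\<bar>f u\<bar> \<le> \<bar>C\<bar>" by force
      then show "norm (f u * ?w u) \<le> norm (C * ?w u)"
        by (simp add: abs_mult mult_right_mono)
    qed
  qed
qed

lemmas integrable_weight = set_borel_integral_eq_integral(1)[OF set_integrable_weight]

text \<open>
  The integrand is the derivative of \<open>(1 - u\<^sup>2) powr k * h u\<close>, which vanishes at both endpoints as
  \<open>k > 0\<close>.
\<close>
lemma weighted_integration_by_parts:
  fixes k :: real and h h' :: "real \<Rightarrow> real"
  assumes "k > 0" and h: "\<And>u. (h has_real_derivative h' u) (at u)"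
  shows "integral {-1..1} (\<lambda>u. ((1 - u\<^sup>2) * h' u - 2 * k * u * h u) * (1 - u\<^sup>2) powr (k - 1)) = 0"
proof -
  let ?F = "\<lambda>u. (1 - u\<^sup>2) powr k * h u"
  have "((\<lambda>u. ((1 - u\<^sup>2) * h' u - 2 * k * u * h u) * (1 - u\<^sup>2) powr (k - 1)) has_integral ?F 1 - ?F (- 1)) {-1..1}"
  proof (rule fundamental_theorem_of_calculus_interior)
    have "continuous_on {-1..1} h"
      using h by (intro continuous_at_imp_continuous_on) (auto intro: DERIV_isCont)
    moreover have "continuous_on {-1..1} (\<lambda>u :: real. (1 - u\<^sup>2) powr k)"
      using assms(1) by (intro continuous_on_powr' continuous_intros) (auto simp: abs_square_le_1)
    ultimately show "continuous_on {-1..1} ?F" by (rule continuous_on_mult[rotated])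
    fix u :: real assume "u \<in> {-1<..<1}"
    then have pos: "1 - u\<^sup>2 > 0" by (auto simp: abs_square_less_1)
    have "(?F has_real_derivative (k * (1 - u\<^sup>2) powr (k - 1) * (- 2 * u)) * h u + h' u * (1 - u\<^sup>2) powr k) (at u)"
      by (rule DERIV_mult[OF _ h], rule DERIV_fun_powr[where r = k, simplified of_nat_1, THEN DERIV_cong])
        (use pos in \<open>auto intro!: derivative_eq_intros\<close>)
    also have "(1 - u\<^sup>2) powr k = (1 - u\<^sup>2) * (1 - u\<^sup>2) powr (k - 1)"
      using pos by (simp add: powr_mult_base)
    finally have "(?F has_real_derivative ((1 - u\<^sup>2) * h' u - 2 * k * u * h u) * (1 - u\<^sup>2) powr (k - 1)) (at u)"
      by (rule DERIV_cong) (simp add: algebra_simps)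
    then show "(?F has_vector_derivative ((1 - u\<^sup>2) * h' u - 2 * k * u * h u) * (1 - u\<^sup>2) powr (k - 1)) (at u)"
      by (simp add: has_real_derivative_iff_has_vector_derivative)
  qed simp
  then show ?thesis using assms(1) by (simp add: integral_unique)
qed

section \<open>The product formula\<close>

lemma continuous_on_product_coeff:
  assumes "\<And>u. (A has_real_derivative A' u) (at u)" "\<And>u. (B has_real_derivative B' u) (at u)"
  shows "continuous_on UNIV (\<lambda>u. product_coeff k q a b (A u) (B u))"
  by (intro continuous_at_imp_continuous_on ballI)
    (rule DERIV_isCont[OF product_coeff_deriv[OF assms]])

text \<open>
  The difference of the two contiguity relations contains the derivatives only as
  \<open>\<partial>\<^sub>A - \<partial>\<^sub>B\<close>, which is a derivative in \<open>u\<close> up to a constant, multiplied by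
  \<open>A B - q = (y1 - y2)\<^sup>2 (1 - u\<^sup>2) / 4\<close>. Together with the remaining term in
  \<open>B - A = - (y1 - y2) u\<close> it has the shape to which integration by parts applies, where
  \<open>h\<close> is a multiple of the coefficient with parameter \<open>k + 1\<close>.
\<close>
lemma product_coeff_integral_recurrence:
  fixes k y1 y2 :: real
  defines "A \<equiv> \<lambda>u. (y1 + y2 + (y1 - y2) * u) / 2" and "B \<equiv> \<lambda>u. (y1 + y2 - (y1 - y2) * u) / 2"
  assumes "k > 0"
  shows "jack_recurrence k n (\<lambda>a. integral {-1..1}
    (\<lambda>u. product_coeff k (y1 * y2) a (n - a) (A u) (B u) * (1 - u\<^sup>2) powr (k - 1)))"
  unfolding jack_recurrence_def
proof (intro allI impI)
  fix i j :: nat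
  assume n: "Suc (i + j) = n"
  let ?q = "y1 * y2" and ?e = "y1 - y2"
  let ?I = "\<lambda>f. integral {-1..1} (\<lambda>u. f u * (1 - u\<^sup>2) powr (k - 1))"
  let ?p = "\<lambda>k a b u. product_coeff k ?q a b (A u) (B u)"
  have A: "(A has_real_derivative ?e / 2) (at u)" and B: "(B has_real_derivative - ?e / 2) (at u)" for u
    unfolding A_def B_def by (auto intro!: derivative_eq_intros)
  define h where "h u = k * ?e / 2 * ?p (k + 1) i j u" for u
  define h' where "h' u = k * ?e / 2 * (product_coeff_dA (k + 1) ?q i j (A u) (B u) * (?e / 2)
      + product_coeff_dB (k + 1) ?q i j (A u) (B u) * (- ?e / 2))" for u
  have h: "(h has_real_derivative h' u) (at u)" for u
    unfolding h_def h'_def by (intro DERIV_cmult product_coeff_deriv A B)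
  have AB: "A u * B u - ?q = ?e\<^sup>2 * (1 - u\<^sup>2) / 4" "B u - A u = - ?e * u" for u
    by (simp_all add: A_def B_def field_simps power2_eq_square)
  have int: "(\<lambda>u. c * ?p k a b u * (1 - u\<^sup>2) powr (k - 1)) integrable_on {-1..1}" for c a b
    by (intro integrable_weight continuous_intros continuous_on_product_coeff[OF A B] \<open>k > 0\<close>)
  have "0 = ?I (\<lambda>u. (1 - u\<^sup>2) * h' u - 2 * k * u * h u)"
    using weighted_integration_by_parts[OF \<open>k > 0\<close> h] by simp
  also have "(\<lambda>u. (1 - u\<^sup>2) * h' u - 2 * k * u * h u) = (\<lambda>u.
      (real j + 1) * (real i + k) * ?p k i (Suc j) u - (real i + 1) * (real j + k) * ?p k (Suc i) j u)"
  proof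
    fix u
    have "(real j + 1) * (real i + k) * ?p k i (Suc j) u - (real i + 1) * (real j + k) * ?p k (Suc i) j u =
        (A u * B u - ?q) * k * (product_coeff_dA (k + 1) ?q i j (A u) (B u) - product_coeff_dB (k + 1) ?q i j (A u) (B u))
        + k * k * (B u - A u) * ?p (k + 1) i j u"
      unfolding product_coeff_contiguity product_coeff_contiguity' by (simp add: algebra_simps)
    also have "\<dots> = (1 - u\<^sup>2) * h' u - 2 * k * u * h u"
      unfolding AB h_def h'_def by (simp add: field_simps power2_eq_square)
    finally show "(1 - u\<^sup>2) * h' u - 2 * k * u * h u =
        (real j + 1) * (real i + k) * ?p k i (Suc j) u - (real i + 1) * (real j + k) * ?p k (Suc i) j u" ..
  qed
  also have "?I \<dots> = (real j + 1) * (real i + k) * ?I (?p k i (Suc j)) - (real i + 1) * (real j + k) * ?I (?p k (Suc i) j)"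
    unfolding left_diff_distrib
    by (subst integral_diff[OF int int]) (simp add: mult.assoc)
  finally show "(real j + 1) * (real i + k) * ?I (?p k i (n - i)) =
      (real i + 1) * (real j + k) * ?I (?p k (Suc i) (n - Suc i))"
    using n by (auto simp: Suc_diff_le)
qed

text \<open>
  By the recurrence the integral is a multiple \<open>K\<close> of \<open>jack_form k n x1 x2\<close>, where \<open>K\<close> is independent of
  \<open>x1\<close> and \<open>x2\<close>; evaluation at \<open>x1 = x2 = 1\<close> gives \<open>K\<close>. The formula involves the
  points \<open>Z1\<close>, \<open>Z2\<close> only through their sum and product.
\<close>
theorem jack_form_product_formula:
  fixes k x1 x2 y1 y2 :: real
  assumes "k > 0" and Z: "\<And>u. Z1 u + Z2 u = prod_alpha x1 x2 y1 y2 u"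
    "\<And>u. u \<in> {-1..1} \<Longrightarrow> Z1 u * Z2 u = x1 * x2 * (y1 * y2)"
  shows "set_integrable lborel {-1..1} (\<lambda>u. jack_form k n (Z1 u) (Z2 u) * (1 - u\<^sup>2) powr (k - 1))"
    and "jack_form k n 1 1 * (LINT u:{-1..1}|lborel. jack_form k n (Z1 u) (Z2 u) * (1 - u\<^sup>2) powr (k - 1)) =
      Gamma k * sqrt pi / Gamma (k + 1 / 2) * (jack_form k n x1 x2 * jack_form k n y1 y2)"
proof -
  let ?w = "\<lambda>u :: real. (1 - u\<^sup>2) powr (k - 1)"
  define A B where "A u = (y1 + y2 + (y1 - y2) * u) / 2" and "B u = (y1 + y2 - (y1 - y2) * u) / 2" for u
  define p where "p a u = product_coeff k (y1 * y2) a (n - a) (A u) (B u)" for a u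
  define C where "C a = integral {-1..1} (\<lambda>u. p a u * ?w u)" for a
  have A: "(A has_real_derivative (y1 - y2) / 2) (at u)" and B: "(B has_real_derivative - (y1 - y2) / 2) (at u)" for u
    unfolding A_def[abs_def] B_def[abs_def] by (auto intro!: derivative_eq_intros)
  have cont: "continuous_on UNIV (\<lambda>u. \<Sum>a\<le>n. p a u * c a)" for c
    unfolding p_def by (intro continuous_intros continuous_on_product_coeff[OF A B])
  have int: "(\<lambda>u. p a u * ?w u * c) integrable_on {-1..1}" for a c
    using integrable_weight[OF \<open>k > 0\<close>, of "\<lambda>u. p a u * c"] continuous_on_product_coeff[OF A B]
    unfolding p_def by (simp add: mult_ac continuous_on_mult_left)
  have I: "integral {-1..1} (\<lambda>u. (\<Sum>a\<le>n. p a u * c a) * ?w u) = (\<Sum>a\<le>n. C a * c a)" for c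
  proof -
    have "integral {-1..1} (\<lambda>u. (\<Sum>a\<le>n. p a u * c a) * ?w u) =
        integral {-1..1} (\<lambda>u. \<Sum>a\<le>n. p a u * ?w u * c a)"
      by (simp add: sum_distrib_right mult_ac)
    also have "\<dots> = (\<Sum>a\<le>n. integral {-1..1} (\<lambda>u. p a u * ?w u * c a))"
      by (rule integral_sum) (use int in auto)
    also have "\<dots> = (\<Sum>a\<le>n. C a * c a)"
      by (simp add: C_def)
    finally show ?thesis .
  qed
  have "jack_recurrence k n C"
    unfolding C_def[abs_def] p_def A_def B_def by (rule product_coeff_integral_recurrence[OF \<open>k > 0\<close>])
  note rec = this
  define K where "K = C 0 / neg_binom_coeff k n"
  have sol: "C a = K * (neg_binom_coeff k a * neg_binom_coeff k (n - a))" if "a \<le> n" for a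
    unfolding K_def by (rule jack_recurrence_solution[OF \<open>k > 0\<close> rec that])
  have F: "(\<Sum>a\<le>n. C a * (s ^ a * t ^ (n - a))) = K * jack_form k n s t" for s t
    unfolding jack_form_def sum_distrib_left by (rule sum.cong) (simp_all add: sol)
  have "K * jack_form k n 1 1 = integral {-1..1} (\<lambda>u. (\<Sum>a\<le>n. p a u * 1) * ?w u)"
    using F[of 1 1] I[of "\<lambda>_. 1"] by simp
  also have "\<dots> = integral {-1..1} (\<lambda>u. jack_form k n y1 y2 * ?w u)"
  proof -
    have "(\<Sum>a\<le>n. p a u * 1) = jack_form k n y1 y2" for u
      unfolding p_def using jack_form_product_expansion[OF \<open>k > 0\<close>, of y1 y2 1 "A u" 1 "B u" "y1 * y2" n]
      by (simp add: A_def B_def field_simps)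
    then show ?thesis by simp
  qed
  also have "\<dots> = jack_form k n y1 y2 * (Gamma k * sqrt pi / Gamma (k + 1 / 2))"
    using integral_unique[OF weight_has_integral[OF \<open>k > 0\<close>]] by simp
  finally have K: "K * jack_form k n 1 1 = jack_form k n y1 y2 * (Gamma k * sqrt pi / Gamma (k + 1 / 2))" .
  have E: "jack_form k n (Z1 u) (Z2 u) = (\<Sum>a\<le>n. p a u * (x1 ^ a * x2 ^ (n - a)))" if "u \<in> {-1..1}" for u
    unfolding p_def
    by (rule jack_form_product_expansion[OF \<open>k > 0\<close>])
      (simp_all add: Z(1) Z(2)[OF that] prod_alpha_def A_def B_def field_simps)
  have cong: "set_integrable lborel {-1..1} (\<lambda>u. jack_form k n (Z1 u) (Z2 u) * ?w u) \<longleftrightarrow>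
      set_integrable lborel {-1..1} (\<lambda>u. (\<Sum>a\<le>n. p a u * (x1 ^ a * x2 ^ (n - a))) * ?w u)"
    by (rule set_integrable_cong) (simp_all add: E)
  show S: "set_integrable lborel {-1..1} (\<lambda>u. jack_form k n (Z1 u) (Z2 u) * ?w u)"
    unfolding cong by (rule set_integrable_weight[OF \<open>k > 0\<close> cont])
  have "(LINT u:{-1..1}|lborel. jack_form k n (Z1 u) (Z2 u) * ?w u) =
      integral {-1..1} (\<lambda>u. (\<Sum>a\<le>n. p a u * (x1 ^ a * x2 ^ (n - a))) * ?w u)"
    unfolding set_borel_integral_eq_integral(2)[OF S] by (rule integral_cong) (simp add: E)
  also have "\<dots> = K * jack_form k n x1 x2"
    unfolding I F ..
  finally have "jack_form k n 1 1 * (LINT u:{-1..1}|lborel. jack_form k n (Z1 u) (Z2 u) * ?w u) =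
      (K * jack_form k n 1 1) * jack_form k n x1 x2"
    by simp
  then show "jack_form k n 1 1 * (LINT u:{-1..1}|lborel. jack_form k n (Z1 u) (Z2 u) * ?w u) =
      Gamma k * sqrt pi / Gamma (k + 1 / 2) * (jack_form k n x1 x2 * jack_form k n y1 y2)"
    unfolding K by (simp only: mult_ac)
qed

text \<open>
  \<open>prod_alpha\<close> is a convex combination of \<open>x1 y1 + x2 y2\<close> and \<open>x1 y2 + x2 y1\<close>, and each of them is at
  least \<open>2 sqrt (x1 x2 y1 y2)\<close> by the inequality of the arithmetic and geometric means.
\<close>
lemma prod_alpha_discriminant_nonneg:
  assumes "x1 \<ge> 0" "x2 \<ge> 0" "y1 \<ge> 0" "y2 \<ge> 0" and u: "u \<in> {-1..1}"
  shows "(prod_alpha x1 x2 y1 y2 u)\<^sup>2 - 4 * x1 * x2 * y1 * y2 \<ge> 0"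
proof -
  let ?r = "2 * sqrt (x1 * x2 * y1 * y2)"
  have p: "x1 * x2 * y1 * y2 \<ge> 0" using assms by simp
  have am: "2 * sqrt (a * b) \<le> a + b" if "a \<ge> 0" "b \<ge> 0" for a b :: real
    using arith_geo_mean_sqrt[OF that] by simp
  have "?r \<le> x1 * y1 + x2 * y2" "?r \<le> x1 * y2 + x2 * y1"
    using am[of "x1 * y1" "x2 * y2"] am[of "x1 * y2" "x2 * y1"] assms by (simp_all add: mult_ac)
  then have "(1 + u) / 2 * ?r + (1 - u) / 2 * ?r \<le>
      (1 + u) / 2 * (x1 * y1 + x2 * y2) + (1 - u) / 2 * (x1 * y2 + x2 * y1)"
    using u by (intro add_mono mult_left_mono) auto
  also have "\<dots> = prod_alpha x1 x2 y1 y2 u"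
    by (simp add: prod_alpha_def field_simps)
  also have "(1 + u) / 2 * ?r + (1 - u) / 2 * ?r = ?r"
    by (simp add: field_simps)
  finally have "?r\<^sup>2 \<le> (prod_alpha x1 x2 y1 y2 u)\<^sup>2"
    using p by (intro power_mono) auto
  then show ?thesis using p by (simp add: power_mult_distrib mult_ac)
qed

theorem theorem2p1:
  fixes k x1 x2 y1 y2 :: real and l :: "nat \<times> nat"
  assumes "k > 0" and "is_partition2 l"
    and "x1 \<ge> 0" and "x2 \<ge> 0" and "y1 \<ge> 0" and "y2 \<ge> 0"
  shows "jack2 k l 1 1 \<noteq> 0 \<and>
    set_integrable lborel {-1..1}
      (\<lambda>u. jack2 k l (prod_X1 x1 x2 y1 y2 u) (prod_X2 x1 x2 y1 y2 u) * (1 - u\<^sup>2) powr (k - 1)) \<and>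
    jack2 k l x1 x2 * jack2 k l y1 y2 / jack2 k l 1 1 =
      Gamma (k + 1 / 2) / (Gamma k * sqrt pi) *
      (LINT u:{-1..1}|lborel.
        jack2 k l (prod_X1 x1 x2 y1 y2 u) (prod_X2 x1 x2 y1 y2 u) * (1 - u\<^sup>2) powr (k - 1))"
proof -
  define s n where "s = snd l" and "n = fst l - snd l"
  have l: "l = (s + n, s)"
    using assms(2) by (cases l) (simp add: is_partition2_def s_def n_def)
  let ?w = "\<lambda>u :: real. (1 - u\<^sup>2) powr (k - 1)"
  let ?X1 = "prod_X1 x1 x2 y1 y2" and ?X2 = "prod_X2 x1 x2 y1 y2"
  let ?N = "jack_norm k n" and ?c = "(x1 * x2 * (y1 * y2)) ^ s"
  let ?J = "LINT u:{-1..1}|lborel. jack_form k n (?X1 u) (?X2 u) * ?w u"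
  have N: "?N > 0" by (rule jack_norm_pos[OF assms(1)])
  have Q: "jack_form k n 1 1 > 0" by (rule jack_form_pos[OF assms(1)])
  have G: "Gamma k > 0" "Gamma (k + 1 / 2) > 0" using assms(1) by (auto intro!: Gamma_real_pos)
  have sum: "?X1 u + ?X2 u = prod_alpha x1 x2 y1 y2 u" for u
    by (simp add: prod_X1_def prod_X2_def field_simps)
  have prod: "?X1 u * ?X2 u = x1 * x2 * (y1 * y2)" if "u \<in> {-1..1}" for u
  proof -
    have "?X1 u * ?X2 u = ((prod_alpha x1 x2 y1 y2 u)\<^sup>2 -
        (sqrt ((prod_alpha x1 x2 y1 y2 u)\<^sup>2 - 4 * x1 * x2 * y1 * y2))\<^sup>2) / 4"
      unfolding prod_X1_def prod_X2_def by (simp add: field_simps power2_eq_square)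
    then show ?thesis
      using prod_alpha_discriminant_nonneg[OF assms(3-6) that] by simp
  qed
  note pf = jack_form_product_formula[OF assms(1) sum prod, of n]
  have jack: "jack2 k l (?X1 u) (?X2 u) * ?w u = ?N * ?c * (jack_form k n (?X1 u) (?X2 u) * ?w u)"
    if "u \<in> {-1..1}" for u
    unfolding l jack2_eq[OF assms(1)] prod[OF that] by simp
  have "set_integrable lborel {-1..1} (\<lambda>u. jack2 k l (?X1 u) (?X2 u) * ?w u) \<longleftrightarrow>
      set_integrable lborel {-1..1} (\<lambda>u. ?N * ?c * (jack_form k n (?X1 u) (?X2 u) * ?w u))"
    by (rule set_integrable_cong) (simp_all add: jack)
  then have int: "set_integrable lborel {-1..1} (\<lambda>u. jack2 k l (?X1 u) (?X2 u) * ?w u)"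
    using pf(1) by simp
  have "(LINT u:{-1..1}|lborel. jack2 k l (?X1 u) (?X2 u) * ?w u) =
      (LINT u:{-1..1}|lborel. ?N * ?c * (jack_form k n (?X1 u) (?X2 u) * ?w u))"
    by (rule set_lebesgue_integral_cong) (simp_all add: jack)
  also have "\<dots> = ?N * ?c * ?J" by (rule set_integral_mult_right)
  finally have J: "(LINT u:{-1..1}|lborel. jack2 k l (?X1 u) (?X2 u) * ?w u) = ?N * ?c * ?J" .
  have "?J = jack_form k n 1 1 * ?J / jack_form k n 1 1" using Q by simp
  also have "jack_form k n 1 1 * ?J =
      Gamma k * sqrt pi / Gamma (k + 1 / 2) * (jack_form k n x1 x2 * jack_form k n y1 y2)"
    by (rule pf(2))
  finally have J': "?J = Gamma k * sqrt pi / Gamma (k + 1 / 2) *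
      (jack_form k n x1 x2 * jack_form k n y1 y2) / jack_form k n 1 1" .
  have "jack2 k l x1 x2 * jack2 k l y1 y2 / jack2 k l 1 1 =
      ?N * ?c * (jack_form k n x1 x2 * jack_form k n y1 y2) / jack_form k n 1 1"
    using N Q by (simp add: l jack2_eq[OF assms(1)] power_mult_distrib)
  also have "\<dots> = Gamma (k + 1 / 2) / (Gamma k * sqrt pi) * (?N * ?c * ?J)"
    unfolding J' using G by (simp add: field_simps)
  finally have "jack2 k l x1 x2 * jack2 k l y1 y2 / jack2 k l 1 1 =
      Gamma (k + 1 / 2) / (Gamma k * sqrt pi) *
      (LINT u:{-1..1}|lborel. jack2 k l (?X1 u) (?X2 u) * ?w u)"
    unfolding J .
  moreover have "jack2 k l 1 1 \<noteq> 0"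
    using N Q by (simp add: l jack2_eq[OF assms(1)])
  ultimately show ?thesis using int by blast
qed

end
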